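(* Let $r>0$, let $\mu$ be the Lebesgue measure on $\mathbb{R}$, and let $f:[a,a+\eta(b,a)]\to[0,\infty)$ be a continuous $r$-preinvex function with respect to $\eta$, with $f(a)\neq f(a+\eta(b,a))$. Case 1. If $f(a+\eta(b,a))>f(a)$, then $$(s)\int_{a}^{a+\eta(b,a)} f(x)\,d\mu\le \min\{\beta,\eta(b,a)\},$$ where $\beta\ge 0$ satisfies the equation $$\beta\big(f^r(a+\eta(b,a))-f^r(a)\big)+\beta^r\eta(b,a)-\eta(b,a)f^r(a+\eta(b,a))=0.$$ Case 2. If $f(a+\eta(b,a))<f(a)$, then $$(s)\int_{a}^{a+\eta(b,a)} f(x)\,d\mu\le \min\{\beta,\eta(b,a)\},$$ where $\beta\ge 0$ satisfies the equation $$\beta\big(f^r(a+\eta(b,a))-f^r(a)\big)-\beta^r\eta(b,a)+\eta(b,a)f^r(a)=0.$$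
   Context: Notation: $f^r(x)=(f(x))^r$. For a measurable $f\ge 0$ and a measurable set $A$, the Sugeno (fuzzy) integral is $(s)\int_A f\,d\mu=\sup_{\alpha\ge 0}\min\{\alpha,\mu(A\cap\{x: f(x)\ge\alpha\})\}$; $(s)\int_c^d$ means $A=[c,d]$. Setting: $K\subset\mathbb{R}$ is a nonempty closed set, $\eta:K\times K\to\mathbb{R}$ is continuous, and $K$ is invex with respect to $\eta$, i.e. $u+t\eta(v,u)\in K$ for all $u,v\in K$, $t\in[0,1]$. It is assumed that $a,b\in K$ and $\eta(b,a)>0$ (so $[a,a+\eta(b,a)]\subset K$), and that $\eta$ satisfies Condition C: for all $x,y\in K$ and $t,t_1,t_2\in[0,1]$, $\eta(y,y+t\eta(x,y))=-t\eta(x,y)$, $\eta(x,y+t\eta(x,y))=(1-t)\eta(x,y)$, and $\eta(y+t_2\eta(x,y),y+t_1\eta(x,y))=(t_2-t_1)\eta(x,y)$. For $r>0$, $f$ is $r$-preinvex with respect to $\eta$ on $[a,a+\eta(b,a)]$ if $f(u+t\eta(v,u))\le\big((1-t)f^r(u)+tf^r(v)\big)^{1/r}$ for all $u,v\in[a,a+\eta(b,a)]$ and $t\in[0,1]$. *)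

theory Defs
  imports "HOL-Analysis.Analysis"
begin

text \<open>The values lie in \<^typ>\<open>ennreal\<close> because the measure of a level set may be infinite.\<close>

definition sugeno_integral :: "'a measure \<Rightarrow> 'a set \<Rightarrow> ('a \<Rightarrow> real) \<Rightarrow> ennreal" where
  "sugeno_integral M A f =
     (SUP \<alpha>\<in>{0::real..}. min (ennreal \<alpha>) (emeasure M (A \<inter> {x. f x \<ge> \<alpha>})))"

definition invex_set :: "real set \<Rightarrow> (real \<Rightarrow> real \<Rightarrow> real) \<Rightarrow> bool" where
  "invex_set K \<eta> \<longleftrightarrow> (\<forall>u\<in>K. \<forall>v\<in>K. \<forall>t\<in>{0..1}. u + t * \<eta> v u \<in> K)"

definition condition_C :: "real set \<Rightarrow> (real \<Rightarrow> real \<Rightarrow> real) \<Rightarrow> bool" where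
  "condition_C K \<eta> \<longleftrightarrow>
     (\<forall>x\<in>K. \<forall>y\<in>K.
        (\<forall>t\<in>{0..1}. \<eta> y (y + t * \<eta> x y) = - t * \<eta> x y) \<and>
        (\<forall>t\<in>{0..1}. \<eta> x (y + t * \<eta> x y) = (1 - t) * \<eta> x y) \<and>
        (\<forall>t1\<in>{0..1}. \<forall>t2\<in>{0..1}.
           \<eta> (y + t2 * \<eta> x y) (y + t1 * \<eta> x y) = (t2 - t1) * \<eta> x y))"

text \<open>Meant for \<open>r > 0\<close> and \<open>f\<close> nonnegative on \<open>S\<close>; then \<open>powr\<close> is the usual real power,
  including \<open>0 powr r = 0\<close>.\<close>

definition r_preinvex_on ::
  "real \<Rightarrow> (real \<Rightarrow> real \<Rightarrow> real) \<Rightarrow> real set \<Rightarrow> (real \<Rightarrow> real) \<Rightarrow> bool" where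
  "r_preinvex_on r \<eta> S f \<longleftrightarrow>
     (\<forall>u\<in>S. \<forall>v\<in>S. \<forall>t\<in>{0..1}.
        f (u + t * \<eta> v u) \<le> ((1 - t) * f u powr r + t * f v powr r) powr (1 / r))"

end

theory Submission
  imports Defs
begin

text \<open>Condition C forces \<open>\<eta> v u = v - u\<close> on \<open>[a, a + \<eta> b a]\<close>, so \<open>f powr r\<close> lies below the chord
  between its endpoint values there. Hence \<open>{f \<ge> \<alpha>}\<close> lies in an interval whose length is affine
  and decreasing in \<open>\<alpha> powr r\<close>; the equation for \<open>\<beta>\<close> says that this length equals \<open>\<alpha>\<close> at
  \<open>\<alpha> = \<beta>\<close>, so each minimum in the Sugeno supremum is at most \<open>\<beta>\<close>.\<close>

text \<open>Splitting at \<beta>: for \<open>\<alpha> \<le> \<beta>\<close> the first entry of the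
  minimum is at most \<beta>, beyond \<beta> the level set is. Hence only levels strictly above
  \<beta> need a measure estimate.\<close>

lemma sugeno_integral_le_min:
  assumes "A \<in> sets M" and "emeasure M A \<le> ennreal c"
    and "\<And>\<alpha>. \<alpha> > \<beta> \<Longrightarrow> emeasure M (A \<inter> {x. f x \<ge> \<alpha>}) \<le> ennreal \<beta>"
  shows "sugeno_integral M A f \<le> ennreal (min \<beta> c)"
  unfolding sugeno_integral_def
proof (rule SUP_least)
  fix \<alpha> :: real
  assume "\<alpha> \<in> {0..}"
  let ?L = "A \<inter> {x. f x \<ge> \<alpha>}"
  have "emeasure M ?L \<le> ennreal c"
    using emeasure_mono[of ?L A M] assms(1,2) by (meson Int_lower1 order_trans)
  moreover have "min (ennreal \<alpha>) (emeasure M ?L) \<le> ennreal \<beta>"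
  proof (cases "\<alpha> \<le> \<beta>")
    case True
    then show ?thesis by (simp add: ennreal_leI min.coboundedI1)
  next
    case False
    then show ?thesis using assms(3) by (simp add: min.coboundedI2)
  qed
  ultimately show "min (ennreal \<alpha>) (emeasure M ?L) \<le> ennreal (min \<beta> c)"
    by (auto simp: min_def)
qed

text \<open>Monotonicity asks only that the enclosing interval be measurable, so level sets can be
  bounded by locating them.\<close>

lemma emeasure_lebesgue_le_interval:
  fixes l u c :: real
  assumes "S \<subseteq> {l..u}" and "u - l \<le> c" and "0 \<le> c"
  shows "emeasure lebesgue S \<le> ennreal c"
proof -
  have "emeasure lebesgue S \<le> emeasure lebesgue {l..u}"
    using assms(1) by (intro emeasure_mono) auto
  also have "\<dots> \<le> ennreal c"
    using assms(2,3) by (auto simp: emeasure_lborel_Icc_eq intro: ennreal_leI)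
  finally show ?thesis .
qed

lemma r_preinvex_on_powr_le_chord:
  assumes "condition_C K \<eta>" and "a \<in> K" and "b \<in> K" and "\<eta> b a > 0" and "r > 0"
    and nonneg: "\<And>x. x \<in> {a..a + \<eta> b a} \<Longrightarrow> f x \<ge> 0"
    and "r_preinvex_on r \<eta> {a..a + \<eta> b a} f"
    and x: "x \<in> {a..a + \<eta> b a}"
  shows "\<eta> b a * f x powr r
    \<le> (a + \<eta> b a - x) * f a powr r + (x - a) * f (a + \<eta> b a) powr r"
proof -
  define e where "e = \<eta> b a"
  define t where "t = (x - a) / e"
  let ?c = "(1 - t) * f a powr r + t * f (a + e) powr r"
  have e: "e > 0" using assms(4) by (simp add: e_def)
  have t: "t \<in> {0..1}" and te: "t * e = x - a"
    using x e by (auto simp: t_def e_def field_simps)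
  \<comment> \<open>Third identity of Condition C with \<open>t2 = 1\<close> and
    \<open>t1 = 0\<close>. It allows r-preinvexity to be applied to the endpoints \<open>a\<close>
    and \<open>a + e\<close>; the point \<open>b\<close> itself may lie outside the
    interval.\<close>
  have "\<eta> (a + 1 * \<eta> b a) (a + 0 * \<eta> b a) = (1 - 0) * \<eta> b a"
    using assms(1-3) unfolding condition_C_def by (meson atLeastAtMost_iff order_refl zero_le_one)
  then have "\<eta> (a + e) a = e" by (simp add: e_def)
  moreover have "f (a + t * \<eta> (a + e) a) \<le> ?c powr (1 / r)"
    using assms(7) e t unfolding r_preinvex_on_def e_def by auto
  ultimately have "f x \<le> ?c powr (1 / r)"
    using te by simp
  then have "f x powr r \<le> (?c powr (1 / r)) powr r"
    using nonneg[OF x] assms(5) by (intro powr_mono2) auto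
  \<comment> \<open>The exponents cancel because \<open>?c\<close>, a convex combination of powers,
    is nonnegative.\<close>
  also have "\<dots> = ?c"
    using assms(5) t by (simp add: powr_powr)
  finally have "e * f x powr r \<le> e * ?c"
    using e by simp
  also have "e * ?c = (e - t * e) * f a powr r + (t * e) * f (a + e) powr r"
    by (simp add: algebra_simps)
  finally show ?thesis
    unfolding te by (simp add: e_def algebra_simps)
qed

theorem theorem3p3:
  fixes K :: "real set" and \<eta> :: "real \<Rightarrow> real \<Rightarrow> real"
    and a b r :: real and f :: "real \<Rightarrow> real"
  assumes "K \<noteq> {}" and "closed K"
    and "continuous_on (K \<times> K) (\<lambda>(x, y). \<eta> x y)"
    and "invex_set K \<eta>"
    and "condition_C K \<eta>"
    and "a \<in> K" and "b \<in> K" and "\<eta> b a > 0"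
    and "r > 0"
    and "\<And>x. x \<in> {a..a + \<eta> b a} \<Longrightarrow> f x \<ge> 0"
    and "continuous_on {a..a + \<eta> b a} f"
    and "r_preinvex_on r \<eta> {a..a + \<eta> b a} f"
    and "f a \<noteq> f (a + \<eta> b a)"
  shows "(f (a + \<eta> b a) > f a \<longrightarrow>
           (\<forall>\<beta>\<ge>0. \<beta> * (f (a + \<eta> b a) powr r - f a powr r) + \<beta> powr r * \<eta> b a
                     - \<eta> b a * f (a + \<eta> b a) powr r = 0 \<longrightarrow>
              sugeno_integral lebesgue {a..a + \<eta> b a} f \<le> ennreal (min \<beta> (\<eta> b a)))) \<and>
         (f (a + \<eta> b a) < f a \<longrightarrow>
           (\<forall>\<beta>\<ge>0. \<beta> * (f (a + \<eta> b a) powr r - f a powr r) - \<beta> powr r * \<eta> b a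
                     + \<eta> b a * f a powr r = 0 \<longrightarrow>
              sugeno_integral lebesgue {a..a + \<eta> b a} f \<le> ennreal (min \<beta> (\<eta> b a))))"
proof -
  define e A B where "e = \<eta> b a" and "A = f a powr r" and "B = f (a + e) powr r"
  have e: "e > 0" using assms(8) by (simp add: e_def)
  have chord: "e * f x powr r \<le> (a + e - x) * A + (x - a) * B" if "x \<in> {a..a + e}" for x
    using r_preinvex_on_powr_le_chord[OF assms(5-10,12)] that by (simp add: e_def A_def B_def)
  \<comment> \<open>The bound is stated with \<beta> instead of \<alpha> so that the equation for
    \<beta> can be substituted for the left-hand side.\<close>
  have level: "e * \<beta> powr r \<le> (a + e - x) * A + (x - a) * B"
    if "x \<in> {a..a + e}" "f x \<ge> \<alpha>" "\<alpha> > \<beta>" "\<beta> \<ge> 0" for x \<alpha> \<beta>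
  proof -
    have "\<beta> powr r \<le> f x powr r"
      using that assms(9) by (intro powr_mono2) auto
    then show ?thesis
      using chord[OF that(1)] e by (smt (verit) mult_left_mono)
  qed
  have e_bound: "emeasure lebesgue {a..a + e} \<le> ennreal e"
    using e by simp
  have ab: "a + e \<in> {a..a + e}" "a \<in> {a..a + e}" using e by auto
  have nonneg: "f a \<ge> 0" "f (a + e) \<ge> 0"
    using assms(10) ab by (auto simp: e_def)
  have "sugeno_integral lebesgue {a..a + e} f \<le> ennreal (min \<beta> e)"
    if lt: "f a < f (a + e)" and \<beta>: "\<beta> \<ge> 0" "\<beta> * (B - A) + \<beta> powr r * e - e * B = 0" for \<beta>
  proof (rule sugeno_integral_le_min[OF _ e_bound])
    fix \<alpha> assume \<alpha>: "\<alpha> > \<beta>"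
    have AB: "A < B"
      using lt nonneg assms(9) by (simp add: A_def B_def powr_less_mono2)
    have "a + e - \<beta> \<le> x" if "x \<in> {a..a + e}" "f x \<ge> \<alpha>" for x
    proof -
      \<comment> \<open>The chord term equals \<open>e * B - (a + e - x) * (B - A)\<close>, and the
        equation reads \<open>e * \<beta> powr r = e * B - \<beta> * (B - A)\<close>. Cancelling
        \<open>B - A > 0\<close> confines the level set to the last stretch of length
        \<beta>.\<close>
      have "(a + e - x) * (B - A) \<le> \<beta> * (B - A)"
        using level[OF that \<alpha> \<beta>(1)] \<beta>(2) by (simp add: algebra_simps)
      then show ?thesis using AB by simp
    qed
    then show "emeasure lebesgue ({a..a + e} \<inter> {x. f x \<ge> \<alpha>}) \<le> ennreal \<beta>"
      using \<beta>(1) by (intro emeasure_lebesgue_le_interval[of _ "a + e - \<beta>" "a + e"]) auto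
  qed simp
  moreover have "sugeno_integral lebesgue {a..a + e} f \<le> ennreal (min \<beta> e)"
    if lt: "f (a + e) < f a" and \<beta>: "\<beta> \<ge> 0" "\<beta> * (B - A) - \<beta> powr r * e + e * A = 0" for \<beta>
  proof (rule sugeno_integral_le_min[OF _ e_bound])
    fix \<alpha> assume \<alpha>: "\<alpha> > \<beta>"
    have AB: "B < A"
      using lt nonneg assms(9) by (simp add: A_def B_def powr_less_mono2)
    have "x \<le> a + \<beta>" if "x \<in> {a..a + e}" "f x \<ge> \<alpha>" for x
    proof -
      \<comment> \<open>Now the chord is decreasing: it is written as
        \<open>e * A - (x - a) * (A - B)\<close>, and the level set lies within \<beta> of the left
        endpoint.\<close>
      have "(x - a) * (A - B) \<le> \<beta> * (A - B)"
        using level[OF that \<alpha> \<beta>(1)] \<beta>(2) by (simp add: algebra_simps)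
      then show ?thesis using AB by simp
    qed
    then show "emeasure lebesgue ({a..a + e} \<inter> {x. f x \<ge> \<alpha>}) \<le> ennreal \<beta>"
      using \<beta>(1) by (intro emeasure_lebesgue_le_interval[of _ a "a + \<beta>"]) auto
  qed simp
  ultimately show ?thesis
    unfolding e_def A_def B_def by blast
qed

end
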